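(* Let $p$ be a prime and let $H_3(p)$ be the Heisenberg group over $\mathbb{Z}/p\mathbb{Z}$. The mixing time of the commuting chain on $H_3(p)$ satisfies \[\frac p4\le t_{mix}\le\left\lceil p\log(4)\right\rceil .\] Furthermore, the sequence of commuting chains on $H_3(p)$ (as $p\to\infty$ through the primes) does not exhibit cutoff.
   Context: $H_3(p)$ is the group, under matrix multiplication, of matrices $\begin{pmatrix}1&a&c\\0&1&b\\0&0&1\end{pmatrix}$ with $a,b,c\in\mathbb{Z}/p\mathbb{Z}$. For a finite group $G$ and $x\in G$, let $C_x=\{h\in G: hx=xh\}$ and let $x^G$ be the conjugacy class of $x$. The commuting chain on $G$ is the Markov chain with state space $G$ and transition matrix $P(x,y)=\frac{1}{|C_x|}\mathbf 1_{\{xy=yx\}}$; its stationary distribution is $\pi(x)=\frac{1}{k|x^G|}$, where $k$ is the number of conjugacy classes of $G$. Total variation distance: $\Vert\mu-\nu\Vert_{TV}=\sup_{A}|\mu(A)-\nu(A)|$. Put $d(t)=\max_x\Vert P^t(x,\cdot)-\pi\Vert_{TV}$, $t_{mix}(\varepsilon)=\min\{t: d(t)\le\varepsilon\}$, and $t_{mix}=t_{mix}(1/4)$. A sequence of chains indexed by a parameter $n\to\infty$ with mixing times $t^{(n)}_{mix}(\varepsilon)$ exhibits cutoff if $\lim_{n\to\infty} t^{(n)}_{mix}(\varepsilon)/t^{(n)}_{mix}(1-\varepsilon)=1$ for all $\varepsilon\in(0,1)$. $\log$ is the natural logarithm. *)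

theory Defs
  imports "HOL-Analysis.Analysis" "HOL-Algebra.Group"
    "HOL-Computational_Algebra.Primes" "HOL-Library.Infinite_Set"
begin

section \<open>Finite Markov chains\<close>

text \<open>A chain on a finite state space \<open>S\<close> is given by a transition matrix \<open>P\<close>; only the
  entries \<open>P x y\<close> with \<open>x, y \<in> S\<close> matter. A distribution on \<open>S\<close> is given by its point masses.\<close>

fun matrix_power_on :: "'a set \<Rightarrow> ('a \<Rightarrow> 'a \<Rightarrow> real) \<Rightarrow> nat \<Rightarrow> 'a \<Rightarrow> 'a \<Rightarrow> real" where
  "matrix_power_on S P 0 x y = of_bool (x = y)"
| "matrix_power_on S P (Suc t) x y = (\<Sum>z\<in>S. matrix_power_on S P t x z * P z y)"

definition tv_dist :: "'a set \<Rightarrow> ('a \<Rightarrow> real) \<Rightarrow> ('a \<Rightarrow> real) \<Rightarrow> real" where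
  "tv_dist S \<mu> \<nu> = (SUP A\<in>Pow S. \<bar>sum \<mu> A - sum \<nu> A\<bar>)"

definition max_tv_dist ::
    "'a set \<Rightarrow> ('a \<Rightarrow> 'a \<Rightarrow> real) \<Rightarrow> ('a \<Rightarrow> real) \<Rightarrow> nat \<Rightarrow> real" where
  "max_tv_dist S P \<pi> t = Max ((\<lambda>x. tv_dist S (matrix_power_on S P t x) \<pi>) ` S)"

definition mixing_time ::
    "'a set \<Rightarrow> ('a \<Rightarrow> 'a \<Rightarrow> real) \<Rightarrow> ('a \<Rightarrow> real) \<Rightarrow> real \<Rightarrow> nat" where
  "mixing_time S P \<pi> \<epsilon> = (LEAST t. max_tv_dist S P \<pi> t \<le> \<epsilon>)"

text \<open>\<open>T n \<epsilon>\<close> is the mixing time of the \<open>n\<close>-th chain of the sequence.\<close>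

definition exhibits_cutoff :: "(nat \<Rightarrow> real \<Rightarrow> nat) \<Rightarrow> bool" where
  "exhibits_cutoff T \<longleftrightarrow>
    (\<forall>\<epsilon>\<in>{0<..<1}. (\<lambda>n. real (T n \<epsilon>) / real (T n (1 - \<epsilon>))) \<longlonglongrightarrow> 1)"

section \<open>The commuting chain on a finite group\<close>

definition centralizer :: "('a, 'b) monoid_scheme \<Rightarrow> 'a \<Rightarrow> 'a set" where
  "centralizer G x = {h \<in> carrier G. h \<otimes>\<^bsub>G\<^esub> x = x \<otimes>\<^bsub>G\<^esub> h}"

definition conjugacy_class :: "('a, 'b) monoid_scheme \<Rightarrow> 'a \<Rightarrow> 'a set" where
  "conjugacy_class G x = (\<lambda>g. g \<otimes>\<^bsub>G\<^esub> x \<otimes>\<^bsub>G\<^esub> inv\<^bsub>G\<^esub> g) ` carrier G"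

definition num_conjugacy_classes :: "('a, 'b) monoid_scheme \<Rightarrow> nat" where
  "num_conjugacy_classes G = card (conjugacy_class G ` carrier G)"

definition commuting_matrix :: "('a, 'b) monoid_scheme \<Rightarrow> 'a \<Rightarrow> 'a \<Rightarrow> real" where
  "commuting_matrix G x y =
    1 / real (card (centralizer G x)) * of_bool (x \<otimes>\<^bsub>G\<^esub> y = y \<otimes>\<^bsub>G\<^esub> x)"

definition commuting_stationary :: "('a, 'b) monoid_scheme \<Rightarrow> 'a \<Rightarrow> real" where
  "commuting_stationary G x =
    1 / (real (num_conjugacy_classes G) * real (card (conjugacy_class G x)))"

definition commuting_mixing_time :: "('a, 'b) monoid_scheme \<Rightarrow> real \<Rightarrow> nat" where
  "commuting_mixing_time G =
    mixing_time (carrier G) (commuting_matrix G) (commuting_stationary G)"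

section \<open>The Heisenberg group over the integers modulo a natural number\<close>

definition heisenberg_matrix :: "int \<Rightarrow> int \<Rightarrow> int \<Rightarrow> int ^ 3 ^ 3" where
  "heisenberg_matrix a b c = vector [vector [1, a, c], vector [0, 1, b], vector [0, 0, 1]]"

text \<open>Residue classes modulo \<open>p\<close> are represented by the integers in \<open>{0..<p}\<close>, and the matrix
  product is reduced entrywise.\<close>

definition heisenberg_group :: "nat \<Rightarrow> (int ^ 3 ^ 3) monoid" where
  "heisenberg_group p =
    \<lparr>carrier = {heisenberg_matrix a b c | a b c.
        a \<in> {0..<int p} \<and> b \<in> {0..<int p} \<and> c \<in> {0..<int p}},
      mult = (\<lambda>A B. \<chi> i j. (A ** B) $ i $ j mod int p),
      one = mat 1\<rparr>"

lemma heisenberg_matrix_eq_iff: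
  "heisenberg_matrix a b c = heisenberg_matrix a' b' c' \<longleftrightarrow> a = a' \<and> b = b' \<and> c = c'"
  by (auto simp: heisenberg_matrix_def vec_eq_iff forall_3)

lemma heisenberg_matrix_0: "heisenberg_matrix 0 0 0 = mat 1"
  by (simp add: heisenberg_matrix_def vec_eq_iff forall_3 mat_def)

lemma heisenberg_mult:
  assumes "1 < p"
  shows "heisenberg_matrix a b c \<otimes>\<^bsub>heisenberg_group p\<^esub> heisenberg_matrix a' b' c' =
    heisenberg_matrix ((a + a') mod int p) ((b + b') mod int p) ((c + c' + a * b') mod int p)"
  using assms
  by (simp add: heisenberg_group_def heisenberg_matrix_def vec_eq_iff forall_3
      matrix_matrix_mult_def sum_3 algebra_simps)

lemma card_heisenberg_group: "card (carrier (heisenberg_group p)) = p ^ 3"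
proof -
  have "carrier (heisenberg_group p) =
      (\<lambda>(a, b, c). heisenberg_matrix a b c) ` ({0..<int p} \<times> {0..<int p} \<times> {0..<int p})"
    by (simp add: heisenberg_group_def set_eq_iff image_iff Bex_def) blast
  moreover have "inj (\<lambda>(a, b, c). heisenberg_matrix a b c)"
    by (auto simp: inj_def heisenberg_matrix_eq_iff)
  ultimately show ?thesis
    by (simp add: card_image inj_on_subset card_cartesian_product power3_eq_cube)
qed

lemma group_heisenberg:
  assumes "1 < p"
  shows "group (heisenberg_group p)"
proof (rule groupI)
  let ?G = "heisenberg_group p"
  have carrier_iff: "x \<in> carrier ?G \<longleftrightarrow> (\<exists>a b c. x = heisenberg_matrix a b c \<and>
      a \<in> {0..<int p} \<and> b \<in> {0..<int p} \<and> c \<in> {0..<int p})" for x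
    by (auto simp: heisenberg_group_def)
  have one: "\<one>\<^bsub>?G\<^esub> = heisenberg_matrix 0 0 0"
    by (simp add: heisenberg_matrix_0) (simp add: heisenberg_group_def)
  show "\<one>\<^bsub>?G\<^esub> \<in> carrier ?G"
    unfolding one carrier_iff using assms by fastforce
  show "x \<otimes>\<^bsub>?G\<^esub> y \<in> carrier ?G" if "x \<in> carrier ?G" "y \<in> carrier ?G" for x y
    using that assms unfolding carrier_iff by (auto simp: heisenberg_mult heisenberg_matrix_eq_iff)
  show "x \<otimes>\<^bsub>?G\<^esub> y \<otimes>\<^bsub>?G\<^esub> z = x \<otimes>\<^bsub>?G\<^esub> (y \<otimes>\<^bsub>?G\<^esub> z)"
    if xyz: "x \<in> carrier ?G" "y \<in> carrier ?G" "z \<in> carrier ?G" for x y z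
  proof -
    obtain a b c a' b' c' a'' b'' c'' where eqs: "x = heisenberg_matrix a b c"
        "y = heisenberg_matrix a' b' c'" "z = heisenberg_matrix a'' b'' c''"
      using xyz carrier_iff by metis
    have "((c + c' + a * b') mod int p + c'' + (a + a') mod int p * b'') mod int p =
        (c + c' + a * b' + c'' + (a + a') * b'') mod int p"
      by (intro mod_add_cong mod_mult_cong) simp_all
    also have "\<dots> = (c + (c' + c'' + a' * b'') + a * (b' + b'')) mod int p"
      by (simp add: algebra_simps)
    also have "\<dots> = (c + (c' + c'' + a' * b'') mod int p + a * ((b' + b'') mod int p)) mod int p"
      by (intro mod_add_cong mod_mult_cong) simp_all
    finally show ?thesis
      using assms by (simp add: eqs heisenberg_mult heisenberg_matrix_eq_iff mod_simps add.assoc)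
  qed
  show "\<one>\<^bsub>?G\<^esub> \<otimes>\<^bsub>?G\<^esub> x = x" if "x \<in> carrier ?G" for x
    using that assms unfolding carrier_iff one by (auto simp: heisenberg_mult)
  show "\<exists>y\<in>carrier ?G. y \<otimes>\<^bsub>?G\<^esub> x = \<one>\<^bsub>?G\<^esub>" if x_in: "x \<in> carrier ?G" for x
  proof -
    obtain a b c where x: "x = heisenberg_matrix a b c"
      using x_in unfolding carrier_iff by blast
    define y where "y = heisenberg_matrix (- a mod int p) (- b mod int p) ((a * b - c) mod int p)"
    have "y \<in> carrier ?G"
      unfolding carrier_iff y_def using assms by (auto simp: heisenberg_matrix_eq_iff)
    moreover have "((a * b - c) mod int p + c + (- a mod int p) * b) mod int p = 0"
    proof -
      have "((a * b - c) mod int p + c + (- a mod int p) * b) mod int p =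
          (a * b - c + c + - a * b) mod int p"
        by (intro mod_add_cong mod_mult_cong) simp_all
      then show ?thesis by simp
    qed
    ultimately show ?thesis
      using assms
      by (intro bexI[of _ y])
        (auto simp: x y_def one heisenberg_mult heisenberg_matrix_eq_iff mod_simps)
  qed
qed

end

theory Submission
  imports Defs "HOL-Algebra.Group_Action"
begin

text \<open>Any two rows of the transition matrix overlap in mass at least \<open>1 / p\<close>, because all
  centralizers contain the center; hence \<open>d t \<le> (1 - 1 / p) ^ t\<close> (Dobrushin). Conversely, the
  centralizer of a noncentral element has order \<open>p ^ 2\<close>, and its noncentral part, of stationary
  mass \<open>(p - 1) / (p ^ 2 + p - 1) \<le> 1 / 5\<close>, is left with probability only \<open>1 / p\<close> at each step, so
  that \<open>d t \<ge> (1 - 1 / p) ^ t - 1 / 5\<close>. Cutoff fails at \<open>\<epsilon> = 1 / 4\<close>: the mixing time is at least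
  \<open>11 p / 20\<close> at level \<open>1 / 4\<close>, but at most \<open>p / 3 + 1\<close> at level \<open>3 / 4\<close>.\<close>

section \<open>Mixing bounds for finite Markov chains\<close>

lemma tv_dist_le:
  assumes "\<And>A. A \<subseteq> S \<Longrightarrow> \<bar>sum \<mu> A - sum \<nu> A\<bar> \<le> e"
  shows "tv_dist S \<mu> \<nu> \<le> e"
  unfolding tv_dist_def by (rule cSUP_least) (use assms in auto)

lemma tv_dist_ge:
  assumes "finite S" "A \<subseteq> S"
  shows "\<bar>sum \<mu> A - sum \<nu> A\<bar> \<le> tv_dist S \<mu> \<nu>"
  unfolding tv_dist_def using assms by (intro cSUP_upper) (auto intro!: bdd_above_finite)

lemma mixing_time_le:
  assumes "max_tv_dist S P \<pi> t \<le> \<epsilon>"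
  shows "mixing_time S P \<pi> \<epsilon> \<le> t"
  unfolding mixing_time_def using assms by (rule Least_le)

text \<open>\<open>LEAST\<close> is informative only if some time reaches the level; the hypothesis
  supplies such a \<open>t\<close>, so the minimum is attained.\<close>

lemma max_tv_dist_mixing_time:
  assumes "max_tv_dist S P \<pi> t \<le> \<epsilon>"
  shows "max_tv_dist S P \<pi> (mixing_time S P \<pi> \<epsilon>) \<le> \<epsilon>"
  unfolding mixing_time_def using assms by (rule LeastI)

section \<open>Contraction and escape bounds for stochastic matrices\<close>

locale finite_markov_chain =
  fixes S :: "'a set" and P :: "'a \<Rightarrow> 'a \<Rightarrow> real"
  assumes finite_states: "finite S" and states_nonempty: "S \<noteq> {}"
    and nonneg: "\<And>x y. x \<in> S \<Longrightarrow> y \<in> S \<Longrightarrow> 0 \<le> P x y"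
    and row_sum: "\<And>x. x \<in> S \<Longrightarrow> (\<Sum>y\<in>S. P x y) = 1"
begin

lemma matrix_power_on_nonneg:
  assumes "x \<in> S" "y \<in> S"
  shows "0 \<le> matrix_power_on S P t x y"
  using assms(2) by (induction t arbitrary: y) (auto intro!: sum_nonneg mult_nonneg_nonneg nonneg)

text \<open>The recursion splits off the last step; the contraction argument conditions on the first
  one.\<close>

lemma matrix_power_on_Suc_left:
  assumes "x \<in> S" "y \<in> S"
  shows "matrix_power_on S P (Suc t) x y = (\<Sum>z\<in>S. P x z * matrix_power_on S P t z y)"
  using assms(2)
proof (induction t arbitrary: y)
  case 0
  then show ?case using assms(1) finite_states
    by (auto simp: of_bool_def if_distribR if_distrib cong: if_cong)
next
  case (Suc t)
  have "matrix_power_on S P (Suc (Suc t)) x y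
      = (\<Sum>w\<in>S. (\<Sum>z\<in>S. P x z * matrix_power_on S P t z w) * P w y)"
    unfolding matrix_power_on.simps(2)[of S P "Suc t"] by (rule sum.cong) (simp_all only: Suc.IH)
  also have "\<dots> = (\<Sum>z\<in>S. \<Sum>w\<in>S. P x z * matrix_power_on S P t z w * P w y)"
    by (subst sum.swap) (simp add: sum_distrib_right)
  also have "\<dots> = (\<Sum>z\<in>S. P x z * matrix_power_on S P (Suc t) z y)"
    by (simp add: sum_distrib_left mult.assoc)
  finally show ?case .
qed

text \<open>The common part \<open>min (P x z) (P y z)\<close> cancels in the difference. What
  remains of each row has mass one minus the overlap, and is bounded by placing it at a maximizer,
  respectively a minimizer, of \<open>f\<close>.\<close>

lemma oscillation_contraction:
  assumes x: "x \<in> S" and y: "y \<in> S"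
    and overlap: "\<delta> \<le> (\<Sum>z\<in>S. min (P x z) (P y z))"
    and osc: "\<And>u v. u \<in> S \<Longrightarrow> v \<in> S \<Longrightarrow> f u - f v \<le> c"
  shows "(\<Sum>z\<in>S. P x z * f z) - (\<Sum>z\<in>S. P y z * f z) \<le> (1 - \<delta>) * c"
proof -
  let ?m = "\<lambda>z. min (P x z) (P y z)"
  let ?o = "\<Sum>z\<in>S. ?m z"
  have "Max (f ` S) \<in> f ` S" "Min (f ` S) \<in> f ` S"
    using finite_states states_nonempty by simp_all
  then obtain u v where uv: "u \<in> S" "f u = Max (f ` S)" "v \<in> S" "f v = Min (f ` S)"
    by (metis imageE)
  have u: "f z \<le> f u" and v: "f v \<le> f z" if "z \<in> S" for z
    using that finite_states uv by simp_all
  have o_le: "?o \<le> 1"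
    using sum_mono[of S ?m "P x"] row_sum[OF x] by simp
  have "(\<Sum>z\<in>S. P x z * f z) - (\<Sum>z\<in>S. P y z * f z)
      = (\<Sum>z\<in>S. (P x z - ?m z) * f z) - (\<Sum>z\<in>S. (P y z - ?m z) * f z)"
    by (simp add: sum_subtractf left_diff_distrib)
  also have "\<dots> \<le> (\<Sum>z\<in>S. (P x z - ?m z) * f u) - (\<Sum>z\<in>S. (P y z - ?m z) * f v)"
    by (intro diff_mono sum_mono mult_left_mono u v) auto
  also have "\<dots> = (1 - ?o) * (f u - f v)"
    unfolding sum_distrib_right[symmetric] sum_subtractf row_sum[OF x] row_sum[OF y]
    by (simp add: right_diff_distrib)
  also have "\<dots> \<le> (1 - \<delta>) * c"
    using osc[OF uv(1,3)] o_le overlap u[OF uv(3)] by (intro mult_mono') auto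
  finally show ?thesis .
qed

text \<open>Apply the one-step contraction to the probability of being in \<open>A\<close> after
  \<open>t\<close> steps, as a function of the start. At time 0 this is the indicator of
  \<open>A\<close>, with oscillation at most 1.\<close>

lemma oscillation_matrix_power_on:
  assumes overlap: "\<And>x y. x \<in> S \<Longrightarrow> y \<in> S \<Longrightarrow> \<delta> \<le> (\<Sum>z\<in>S. min (P x z) (P y z))"
    and A: "A \<subseteq> S" and "x \<in> S" "y \<in> S"
  shows "(\<Sum>z\<in>A. matrix_power_on S P t x z) - (\<Sum>z\<in>A. matrix_power_on S P t y z) \<le> (1 - \<delta>) ^ t"
  using assms(3,4)
proof (induction t arbitrary: x y)
  case 0
  then show ?case
    using finite_subset[OF A finite_states] by (simp add: of_bool_def)
next
  case (Suc t)
  have step: "(\<Sum>z\<in>A. matrix_power_on S P (Suc t) u z)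
      = (\<Sum>w\<in>S. P u w * (\<Sum>z\<in>A. matrix_power_on S P t w z))" if "u \<in> S" for u
  proof -
    have "(\<Sum>z\<in>A. matrix_power_on S P (Suc t) u z)
        = (\<Sum>z\<in>A. \<Sum>w\<in>S. P u w * matrix_power_on S P t w z)"
      using A that by (intro sum.cong matrix_power_on_Suc_left) auto
    then show ?thesis
      by (subst (asm) sum.swap) (simp add: sum_distrib_left)
  qed
  show ?case
    unfolding step[OF Suc.prems(1)] step[OF Suc.prems(2)] power_Suc
    by (rule oscillation_contraction[OF Suc.prems overlap[OF Suc.prems] Suc.IH])
qed

lemma stationary_matrix_power_on:
  assumes stat: "\<And>y. y \<in> S \<Longrightarrow> (\<Sum>x\<in>S. \<pi> x * P x y) = \<pi> y" and "y \<in> S"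
  shows "(\<Sum>x\<in>S. \<pi> x * matrix_power_on S P t x y) = \<pi> y"
  using assms(2)
proof (induction t arbitrary: y)
  case 0
  then show ?case using finite_states by (simp add: of_bool_def if_distrib cong: if_cong)
next
  case (Suc t)
  have "(\<Sum>x\<in>S. \<pi> x * matrix_power_on S P (Suc t) x y)
      = (\<Sum>z\<in>S. (\<Sum>x\<in>S. \<pi> x * matrix_power_on S P t x z) * P z y)"
    by (simp add: sum_distrib_left sum_distrib_right mult.assoc) (rule sum.swap)
  also have "\<dots> = \<pi> y"
    using Suc by (simp add: stat)
  finally show ?case .
qed

text \<open>By stationarity the mass of \<open>A\<close> under \<pi> is the \<pi>-average over
  \<open>y\<close> of the probability of reaching \<open>A\<close> from \<open>y\<close>. So the
  deviation at \<open>x\<close> is an average of differences between two starting points, which the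
  oscillation bound controls in both directions.\<close>

theorem max_tv_dist_le_overlap:
  assumes overlap: "\<And>x y. x \<in> S \<Longrightarrow> y \<in> S \<Longrightarrow> \<delta> \<le> (\<Sum>z\<in>S. min (P x z) (P y z))"
    and stat: "\<And>y. y \<in> S \<Longrightarrow> (\<Sum>x\<in>S. \<pi> x * P x y) = \<pi> y"
    and pi_nonneg: "\<And>x. x \<in> S \<Longrightarrow> 0 \<le> \<pi> x" and pi_sum: "(\<Sum>x\<in>S. \<pi> x) = 1"
  shows "max_tv_dist S P \<pi> t \<le> (1 - \<delta>) ^ t"
proof -
  have "tv_dist S (matrix_power_on S P t x) \<pi> \<le> (1 - \<delta>) ^ t" if x: "x \<in> S" for x
  proof (rule tv_dist_le)
    fix A assume A: "A \<subseteq> S"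
    let ?f = "\<lambda>x. \<Sum>z\<in>A. matrix_power_on S P t x z"
    have "sum \<pi> A = (\<Sum>z\<in>A. \<Sum>y\<in>S. \<pi> y * matrix_power_on S P t y z)"
      using A by (intro sum.cong) (auto simp: stationary_matrix_power_on[OF stat])
    also have "\<dots> = (\<Sum>y\<in>S. \<pi> y * ?f y)"
      by (subst sum.swap) (simp add: sum_distrib_left)
    finally have "?f x - sum \<pi> A = (\<Sum>y\<in>S. \<pi> y * (?f x - ?f y))"
      by (simp add: right_diff_distrib sum_subtractf sum_distrib_right[symmetric] pi_sum)
    also have "\<bar>\<dots>\<bar> \<le> (\<Sum>y\<in>S. \<bar>\<pi> y * (?f x - ?f y)\<bar>)"
      by (rule sum_abs)
    also have "\<dots> \<le> (\<Sum>y\<in>S. \<pi> y * (1 - \<delta>) ^ t)"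
    proof (rule sum_mono)
      fix y assume y: "y \<in> S"
      have "\<bar>?f x - ?f y\<bar> \<le> (1 - \<delta>) ^ t"
        using oscillation_matrix_power_on[OF overlap A x y, of t]
          oscillation_matrix_power_on[OF overlap A y x, of t] by linarith
      then show "\<bar>\<pi> y * (?f x - ?f y)\<bar> \<le> \<pi> y * (1 - \<delta>) ^ t"
        using pi_nonneg[OF y] by (simp add: abs_mult mult_left_mono)
    qed
    also have "\<dots> = (1 - \<delta>) ^ t"
      by (simp add: sum_distrib_right[symmetric] pi_sum)
    finally show "\<bar>?f x - sum \<pi> A\<bar> \<le> (1 - \<delta>) ^ t" .
  qed
  then show ?thesis
    unfolding max_tv_dist_def using finite_states states_nonempty by simp
qed

text \<open>Only trajectories that remain in \<open>L\<close> throughout are counted; each step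
  keeps at least a fraction \<open>q\<close> of them.\<close>

lemma stay_probability_ge:
  assumes L: "L \<subseteq> S" and x: "x \<in> L" and q: "0 \<le> q"
    and stay: "\<And>y. y \<in> L \<Longrightarrow> q \<le> (\<Sum>z\<in>L. P y z)"
  shows "q ^ t \<le> (\<Sum>z\<in>L. matrix_power_on S P t x z)"
proof (induction t)
  case 0
  then show ?case using x finite_subset[OF L finite_states] by (simp add: of_bool_def)
next
  case (Suc t)
  have "q ^ Suc t \<le> (\<Sum>z\<in>L. matrix_power_on S P t x z) * q"
    using mult_right_mono[OF Suc q] by (simp add: mult.commute)
  also have "\<dots> \<le> (\<Sum>z\<in>L. matrix_power_on S P t x z * (\<Sum>y\<in>L. P z y))"
    unfolding sum_distrib_right
    using L x by (intro sum_mono mult_left_mono stay matrix_power_on_nonneg) auto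
  \<comment> \<open>The extra nonnegative terms are trajectories outside \<open>L\<close> at time
    \<open>t\<close> that enter it at the next step.\<close>
  also have "\<dots> \<le> (\<Sum>z\<in>S. matrix_power_on S P t x z * (\<Sum>y\<in>L. P z y))"
    using L x finite_states
    by (intro sum_mono2 mult_nonneg_nonneg sum_nonneg nonneg matrix_power_on_nonneg) auto
  also have "\<dots> = (\<Sum>y\<in>L. matrix_power_on S P (Suc t) x y)"
    by (simp add: sum_distrib_left) (rule sum.swap)
  finally show ?case .
qed

text \<open>The set \<open>L\<close> itself serves as test event, with the chain started inside
  it.\<close>

theorem max_tv_dist_ge_stay:
  assumes L: "L \<subseteq> S" "x \<in> L" "0 \<le> q"
    and stay: "\<And>y. y \<in> L \<Longrightarrow> q \<le> (\<Sum>z\<in>L. P y z)"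
  shows "q ^ t - sum \<pi> L \<le> max_tv_dist S P \<pi> t"
proof -
  have "q ^ t - sum \<pi> L \<le> \<bar>sum (matrix_power_on S P t x) L - sum \<pi> L\<bar>"
    using stay_probability_ge[OF L stay, of t] by linarith
  also have "\<dots> \<le> tv_dist S (matrix_power_on S P t x) \<pi>"
    by (rule tv_dist_ge[OF finite_states L(1)])
  also have "\<dots> \<le> max_tv_dist S P \<pi> t"
    unfolding max_tv_dist_def using finite_states L by (intro Max_ge) auto
  finally show ?thesis .
qed

end

section \<open>Centralizers and the stationary distribution\<close>

context group
begin

text \<open>Orbit-stabilizer for conjugation: the class is the orbit and the centralizer the
  stabilizer.\<close>

lemma card_centralizer_conjugacy_class:
  assumes "x \<in> carrier G"
  shows "card (centralizer G x) * card (conjugacy_class G x) = order G"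
proof -
  let ?\<phi> = "\<lambda>g. \<lambda>h \<in> carrier G. g \<otimes> h \<otimes> inv g"
  have "orbit G ?\<phi> x = conjugacy_class G x"
    using assms by (auto simp: orbit_def conjugacy_class_def)
  moreover have "stabilizer G ?\<phi> x = centralizer G x"
    using assms by (auto simp: stabilizer_def centralizer_def inv_solve_right')
  ultimately show ?thesis
    using group_action.orbit_stabilizer_theorem[OF action_by_conjugation assms]
    by (simp add: mult.commute)
qed

section \<open>Conjugacy classes as a partition\<close>

lemma mem_conjugacy_class_self: "x \<in> carrier G \<Longrightarrow> x \<in> conjugacy_class G x"
  unfolding conjugacy_class_def by (rule image_eqI[of _ _ \<one>]) auto

lemma conjugacy_class_subset: "x \<in> carrier G \<Longrightarrow> conjugacy_class G x \<subseteq> carrier G"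
  by (auto simp: conjugacy_class_def)

lemma conjugacy_class_conjugate_subset:
  assumes "x \<in> carrier G" "y \<in> conjugacy_class G x"
  shows "conjugacy_class G y \<subseteq> conjugacy_class G x"
proof
  fix z assume "z \<in> conjugacy_class G y"
  then obtain g h where "g \<in> carrier G" "h \<in> carrier G"
    "z = h \<otimes> (g \<otimes> x \<otimes> inv g) \<otimes> inv h"
    using assms by (auto simp: conjugacy_class_def)
  then show "z \<in> conjugacy_class G x"
    unfolding conjugacy_class_def using assms(1)
    by (intro image_eqI[of _ _ "h \<otimes> g"]) (auto simp: inv_mult_group m_assoc)
qed

lemma conjugacy_class_sym:
  assumes "x \<in> carrier G" "y \<in> conjugacy_class G x"
  shows "x \<in> conjugacy_class G y"
proof -
  obtain g where g: "g \<in> carrier G" "y = g \<otimes> x \<otimes> inv g"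
    using assms by (auto simp: conjugacy_class_def)
  then have "x = inv g \<otimes> y \<otimes> inv (inv g)"
    using assms(1) by (simp add: m_assoc inv_solve_left)
  then show ?thesis
    using g unfolding conjugacy_class_def by blast
qed

lemma conjugacy_class_eq_iff:
  assumes "x \<in> carrier G" "y \<in> carrier G"
  shows "conjugacy_class G y = conjugacy_class G x \<longleftrightarrow> y \<in> conjugacy_class G x"
  using assms mem_conjugacy_class_self conjugacy_class_conjugate_subset conjugacy_class_sym
  by (metis subset_antisym)

text \<open>Grouped by classes, every class contributes total weight 1. This normalizes the
  stationary distribution, and read backwards it counts the classes of the Heisenberg group.\<close>

lemma sum_inverse_card_conjugacy_class:
  assumes fin: "finite (carrier G)"
  shows "(\<Sum>x\<in>carrier G. 1 / real (card (conjugacy_class G x))) = real (num_conjugacy_classes G)"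
proof -
  have "(\<Sum>x\<in>carrier G. 1 / real (card (conjugacy_class G x)))
      = (\<Sum>C\<in>conjugacy_class G ` carrier G.
          \<Sum>x\<in>{x \<in> carrier G. conjugacy_class G x = C}. 1 / real (card (conjugacy_class G x)))"
    by (rule sum.image_gen[OF fin])
  also have "\<dots> = (\<Sum>C\<in>conjugacy_class G ` carrier G. 1)"
  proof (rule sum.cong[OF refl])
    fix C assume "C \<in> conjugacy_class G ` carrier G"
    then obtain y where y: "y \<in> carrier G" "C = conjugacy_class G y" by blast
    have C: "{x \<in> carrier G. conjugacy_class G x = C} = C"
      using y conjugacy_class_subset[OF y(1)] conjugacy_class_eq_iff[OF y(1)] by blast
    have "card C \<noteq> 0"
      using y mem_conjugacy_class_self finite_subset[OF conjugacy_class_subset fin]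
      by (metis card_0_eq empty_iff)
    moreover have "(\<Sum>x\<in>{x \<in> carrier G. conjugacy_class G x = C}. 1 / real (card (conjugacy_class G x)))
        = (\<Sum>x\<in>C. 1 / real (card C))"
      by (rule sum.cong) (use C in auto)
    ultimately show "(\<Sum>x\<in>{x \<in> carrier G. conjugacy_class G x = C}.
        1 / real (card (conjugacy_class G x))) = 1"
      by simp
  qed
  finally show ?thesis by (simp add: num_conjugacy_classes_def)
qed

lemma num_conjugacy_classes_pos:
  assumes "finite (carrier G)"
  shows "0 < num_conjugacy_classes G"
  unfolding num_conjugacy_classes_def using assms by (auto simp: card_gt_0_iff)

section \<open>The commuting chain: stationarity and overlap of rows\<close>

lemma sum_commuting_stationary:
  assumes "finite (carrier G)"
  shows "(\<Sum>x\<in>carrier G. commuting_stationary G x) = 1"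
proof -
  have "(\<Sum>x\<in>carrier G. commuting_stationary G x) = 1 / num_conjugacy_classes G *
      (\<Sum>x\<in>carrier G. 1 / real (card (conjugacy_class G x)))"
    unfolding commuting_stationary_def sum_distrib_left by simp
  then show ?thesis
    using num_conjugacy_classes_pos[OF assms]
    by (simp add: sum_inverse_card_conjugacy_class[OF assms])
qed

lemma finite_centralizer:
  "finite (carrier G) \<Longrightarrow> finite (centralizer G x)"
  by (simp add: centralizer_def)

lemma card_centralizer_pos:
  assumes "finite (carrier G)" "x \<in> carrier G"
  shows "0 < card (centralizer G x)"
  using assms by (auto simp: card_gt_0_iff centralizer_def)

lemma sum_commuting_matrix:
  assumes "finite (carrier G)" "A \<subseteq> carrier G"
  shows "(\<Sum>y\<in>A. commuting_matrix G x y) = card (A \<inter> centralizer G x) / card (centralizer G x)"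
proof -
  have "{y \<in> A. x \<otimes> y = y \<otimes> x} = A \<inter> centralizer G x"
    using assms(2) by (auto simp: centralizer_def)
  moreover have "finite A" using assms finite_subset by blast
  ultimately show ?thesis
    unfolding commuting_matrix_def sum_distrib_left[symmetric]
    by (simp add: Int_def conj_commute)
qed

lemma commuting_chain:
  assumes "finite (carrier G)"
  shows "finite_markov_chain (carrier G) (commuting_matrix G)"
proof
  show "(\<Sum>y\<in>carrier G. commuting_matrix G x y) = 1" if "x \<in> carrier G" for x
    using sum_commuting_matrix[OF assms order_refl, of x] card_centralizer_pos[OF assms that]
    by (simp add: inf.absorb2 centralizer_def)
qed (use assms in \<open>auto simp: commuting_matrix_def\<close>)

text \<open>Orbit-stabilizer gives \<open>\<pi> x / |C x| = 1 / (k |G|)\<close>, so the chain is reversible.\<close>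

lemma commuting_stationary_stationary:
  assumes fin: "finite (carrier G)" and y: "y \<in> carrier G"
  shows "(\<Sum>x\<in>carrier G. commuting_stationary G x * commuting_matrix G x y)
    = commuting_stationary G y"
proof -
  have "commuting_stationary G x * commuting_matrix G x z
      = of_bool (x \<otimes> z = z \<otimes> x) / (real (num_conjugacy_classes G) * real (order G))"
    if "x \<in> carrier G" for x z
    unfolding commuting_stationary_def commuting_matrix_def
      card_centralizer_conjugacy_class[OF that, symmetric]
    by (simp add: ac_simps)
  then have "commuting_stationary G x * commuting_matrix G x y
      = commuting_stationary G y * commuting_matrix G y x" if "x \<in> carrier G" for x
    using that y by (simp add: eq_commute)
  then have "(\<Sum>x\<in>carrier G. commuting_stationary G x * commuting_matrix G x y)
      = commuting_stationary G y * (\<Sum>x\<in>carrier G. commuting_matrix G y x)"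
    by (simp add: sum_distrib_left)
  then show ?thesis
    using finite_markov_chain.row_sum[OF commuting_chain[OF fin] y] by simp
qed

text \<open>Each row is uniform on a centralizer, so on the intersection the smaller entry is the
  reciprocal of the larger centralizer order.\<close>

lemma commuting_overlap_ge:
  fixes \<delta> :: real
  assumes fin: "finite (carrier G)" and x: "x \<in> carrier G" and y: "y \<in> carrier G"
    and bound: "\<delta> * card (centralizer G x) \<le> card (centralizer G x \<inter> centralizer G y)"
      "\<delta> * card (centralizer G y) \<le> card (centralizer G x \<inter> centralizer G y)"
  shows "\<delta> \<le> (\<Sum>z\<in>carrier G. min (commuting_matrix G x z) (commuting_matrix G y z))"
proof -
  let ?I = "centralizer G x \<inter> centralizer G y"
  let ?M = "max (real (card (centralizer G x))) (real (card (centralizer G y)))"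
  have M: "0 < ?M" using card_centralizer_pos[OF fin x] by simp
  have sub: "?I \<subseteq> carrier G" by (auto simp: centralizer_def)
  have "\<delta> * ?M \<le> card ?I" using bound by (simp add: max_def)
  then have "\<delta> \<le> card ?I * (1 / ?M)" using M by (simp add: field_simps)
  also have "\<dots> = (\<Sum>z\<in>?I. 1 / ?M)" by simp
  also have "\<dots> \<le> (\<Sum>z\<in>?I. min (commuting_matrix G x z) (commuting_matrix G y z))"
  proof (rule sum_mono)
    fix z assume "z \<in> ?I"
    then have "x \<otimes> z = z \<otimes> x" "y \<otimes> z = z \<otimes> y" by (auto simp: centralizer_def)
    then show "1 / ?M \<le> min (commuting_matrix G x z) (commuting_matrix G y z)"
      using card_centralizer_pos[OF fin x] card_centralizer_pos[OF fin y]
      by (auto simp: commuting_matrix_def intro!: divide_left_mono)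
  qed
  also have "\<dots> \<le> (\<Sum>z\<in>carrier G. min (commuting_matrix G x z) (commuting_matrix G y z))"
    using sub fin by (intro sum_mono2) (auto simp: commuting_matrix_def)
  finally show ?thesis .
qed

end

section \<open>The Heisenberg group\<close>

context
  fixes p :: nat
  assumes p: "prime p"
begin

interpretation group "heisenberg_group p"
  using group_heisenberg prime_gt_1_nat[OF p] .

private abbreviation (input) "H \<equiv> heisenberg_group p"
private abbreviation (input) "Z \<equiv> heisenberg_matrix 0 0 ` {0..<int p}"

section \<open>Commutation and the center of the Heisenberg group\<close>

lemma p_gt_1: "1 < p"
  using prime_gt_1_nat[OF p] .

lemma heisenberg_matrix_mem_iff:
  "heisenberg_matrix a b c \<in> carrier H \<longleftrightarrow>
    a \<in> {0..<int p} \<and> b \<in> {0..<int p} \<and> c \<in> {0..<int p}"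
  by (auto simp: heisenberg_group_def heisenberg_matrix_eq_iff)

lemma heisenberg_carrierE:
  assumes "x \<in> carrier H"
  obtains a b c where "x = heisenberg_matrix a b c"
    "a \<in> {0..<int p}" "b \<in> {0..<int p}" "c \<in> {0..<int p}"
  using assms by (auto simp: heisenberg_group_def)

lemma finite_heisenberg: "finite (carrier H)"
  using card_heisenberg_group[of p] p_gt_1 by (intro card_ge_0_finite) simp

text \<open>Only the corner entry depends on the order of the factors: the products contribute
  \<open>a * b'\<close> and \<open>a' * b\<close> to it.\<close>

lemma heisenberg_commute_iff:
  "heisenberg_matrix a b c \<otimes>\<^bsub>H\<^esub> heisenberg_matrix a' b' c'
      = heisenberg_matrix a' b' c' \<otimes>\<^bsub>H\<^esub> heisenberg_matrix a b c \<longleftrightarrow>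
    int p dvd a * b' - a' * b"
  by (simp add: heisenberg_mult[OF p_gt_1] heisenberg_matrix_eq_iff add.commute
      mod_eq_dvd_iff)

lemma mem_centralizer_heisenberg_iff:
  assumes "heisenberg_matrix a' b' c' \<in> carrier H"
  shows "heisenberg_matrix a' b' c' \<in> centralizer H (heisenberg_matrix a b c) \<longleftrightarrow>
    int p dvd a' * b - a * b'"
  using assms by (simp add: centralizer_def heisenberg_commute_iff)

lemma residue_dvd_iff: "a \<in> {0..<int p} \<Longrightarrow> int p dvd a \<longleftrightarrow> a = 0"
  using zdvd_not_zless[of a "int p"] by (cases "a = 0") auto

lemma center_subset_carrier: "Z \<subseteq> carrier H"
  using p_gt_1 by (auto simp: heisenberg_matrix_mem_iff)

lemma card_center: "card Z = p"
  by (subst card_image) (auto simp: inj_on_def heisenberg_matrix_eq_iff)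

lemma center_subset_centralizer:
  assumes "x \<in> carrier H"
  shows "Z \<subseteq> centralizer H x"
proof
  fix z assume z: "z \<in> Z"
  then have "z \<in> carrier H" using center_subset_carrier by blast
  moreover obtain a b c where "x = heisenberg_matrix a b c"
    using heisenberg_carrierE[OF assms] by blast
  ultimately show "z \<in> centralizer H x"
    using z by (auto simp: mem_centralizer_heisenberg_iff)
qed

text \<open>By the previous lemma \<open>x\<close> lies in the centralizer of every element, and
  commuting is symmetric.\<close>

lemma centralizer_central:
  assumes "x \<in> Z"
  shows "centralizer H x = carrier H"
  using center_subset_centralizer assms by (fastforce simp: centralizer_def)

text \<open>The entries \<open>a\<close> and \<open>b\<close> add under multiplication modulo
  \<open>p\<close>, so conjugation preserves them.\<close>

lemma conjugacy_class_heisenberg_subset: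
  assumes x: "heisenberg_matrix a b c \<in> carrier H"
  shows "conjugacy_class H (heisenberg_matrix a b c) \<subseteq> heisenberg_matrix a b ` {0..<int p}"
proof
  fix y assume y: "y \<in> conjugacy_class H (heisenberg_matrix a b c)"
  then have "y \<in> carrier H" using conjugacy_class_subset x by blast
  then obtain a' b' c' where y': "y = heisenberg_matrix a' b' c'"
    "a' \<in> {0..<int p}" "b' \<in> {0..<int p}" "c' \<in> {0..<int p}"
    by (rule heisenberg_carrierE)
  obtain g where g: "g \<in> carrier H"
    "y = g \<otimes>\<^bsub>H\<^esub> heisenberg_matrix a b c \<otimes>\<^bsub>H\<^esub> inv\<^bsub>H\<^esub> g"
    using y by (auto simp: conjugacy_class_def)
  \<comment> \<open>In this form the entries can be compared without computing the inverse of
    \<open>g\<close>.\<close>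
  then have eq: "y \<otimes>\<^bsub>H\<^esub> g = g \<otimes>\<^bsub>H\<^esub> heisenberg_matrix a b c"
    using x by (simp add: m_assoc)
  obtain u v w where "g = heisenberg_matrix u v w"
    using heisenberg_carrierE[OF g(1)] by blast
  with eq have "(a' + u) mod int p = (u + a) mod int p" "(b' + v) mod int p = (v + b) mod int p"
    unfolding y' by (auto simp: heisenberg_mult[OF p_gt_1] heisenberg_matrix_eq_iff)
  then have "int p dvd a' - a" "int p dvd b' - b"
    by (simp_all add: mod_eq_dvd_iff)
  then have "a' mod int p = a mod int p" "b' mod int p = b mod int p"
    by (simp_all add: mod_eq_dvd_iff)
  then have "a' = a" "b' = b"
    using x y' by (simp_all add: heisenberg_matrix_mem_iff)
  then show "y \<in> heisenberg_matrix a b ` {0..<int p}" using y' by blast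
qed

text \<open>The class of a noncentral element lies in a coset of the center, and its size divides
  \<open>p ^ 3\<close>; hence it is the whole coset.\<close>

lemma card_conjugacy_class_noncentral:
  assumes x: "x \<in> carrier H" "x \<notin> Z"
  shows "card (conjugacy_class H x) = p"
proof -
  obtain a b c where abc: "x = heisenberg_matrix a b c"
    "a \<in> {0..<int p}" "b \<in> {0..<int p}" "c \<in> {0..<int p}"
    using x(1) by (rule heisenberg_carrierE)
  have sub: "conjugacy_class H x \<subseteq> heisenberg_matrix a b ` {0..<int p}"
    using conjugacy_class_heisenberg_subset x(1) unfolding abc by blast
  have le: "card (conjugacy_class H x) \<le> p"
    using surj_card_le[OF _ sub] by simp
  have "card (conjugacy_class H x) dvd p ^ 3"
    using card_centralizer_conjugacy_class[OF x(1)]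
    unfolding order_def card_heisenberg_group by (metis dvd_triv_right)
  then obtain i where i: "card (conjugacy_class H x) = p ^ i"
    using divides_primepow_nat[OF p] by blast
  have "i \<le> 1"
  proof (rule ccontr)
    assume "\<not> i \<le> 1"
    then have "p ^ 1 < p ^ i" using p_gt_1 by (intro power_strict_increasing) auto
    then show False using i le by simp
  qed
  moreover have "i \<noteq> 0"
  proof
    assume "i = 0"
    then have "card (centralizer H x) = card (carrier H)"
      using card_centralizer_conjugacy_class[OF x(1)] i by (simp add: order_def)
    then have "centralizer H x = carrier H"
      by (intro card_subset_eq finite_heisenberg) (auto simp: centralizer_def)
    \<comment> \<open>Commuting with the first matrix forces \<open>b = 0\<close>, with the second
      \<open>a = 0\<close>, which would make \<open>x\<close> central.\<close>
    then have "heisenberg_matrix 1 0 0 \<in> centralizer H x" "heisenberg_matrix 0 1 0 \<in> centralizer H x"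
      using p_gt_1 by (auto simp: heisenberg_matrix_mem_iff)
    then have "int p dvd a" "int p dvd b"
      unfolding abc centralizer_def by (auto simp: heisenberg_commute_iff)
    then show False using abc x(2) by (simp add: residue_dvd_iff)
  qed
  ultimately have "i = 1" by simp
  with i show ?thesis by simp
qed

section \<open>Centralizer orders and the number of classes\<close>

lemma card_centralizer_noncentral:
  assumes "x \<in> carrier H" "x \<notin> Z"
  shows "card (centralizer H x) = p ^ 2"
  using card_centralizer_conjugacy_class[OF assms(1)] p_gt_1
  by (simp add: card_conjugacy_class_noncentral[OF assms] order_def card_heisenberg_group
      power2_eq_square power3_eq_cube)

lemma card_conjugacy_class_central:
  assumes "x \<in> Z"
  shows "card (conjugacy_class H x) = 1"
proof -
  have "x \<in> carrier H" using assms center_subset_carrier by blast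
  from card_centralizer_conjugacy_class[OF this] show ?thesis
    using p_gt_1 by (simp add: centralizer_central[OF assms] order_def card_heisenberg_group)
qed

text \<open>In the weighted count, the \<open>p ^ 3 - p\<close> noncentral elements weigh
  \<open>1 / p\<close> each and the \<open>p\<close> central ones weigh 1 each.\<close>

lemma num_conjugacy_classes_heisenberg: "real (num_conjugacy_classes H) = real p ^ 2 + real p - 1"
proof -
  have "real (num_conjugacy_classes H)
      = (\<Sum>x\<in>carrier H - Z. 1 / real (card (conjugacy_class H x)))
        + (\<Sum>x\<in>Z. 1 / real (card (conjugacy_class H x)))"
    unfolding sum_inverse_card_conjugacy_class[OF finite_heisenberg, symmetric]
    by (rule sum.subset_diff[OF center_subset_carrier finite_heisenberg])
  also have "(\<Sum>x\<in>carrier H - Z. 1 / real (card (conjugacy_class H x)))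
      = (\<Sum>x\<in>carrier H - Z. 1 / real p)"
    by (rule sum.cong) (auto simp: card_conjugacy_class_noncentral)
  also have "(\<Sum>x\<in>Z. 1 / real (card (conjugacy_class H x))) = (\<Sum>x\<in>Z. 1)"
    by (rule sum.cong) (simp_all add: card_conjugacy_class_central)
  also have "card (carrier H - Z) = p ^ 3 - p"
    using center_subset_carrier by (simp add: card_Diff_subset card_center card_heisenberg_group)
  then have "(\<Sum>x\<in>carrier H - Z. 1 / real p) = real (p ^ 3 - p) / real p" by simp
  also have "real (p ^ 3 - p) = real p ^ 3 - real p"
    using p_gt_1 self_le_power[of p 3] by (simp add: of_nat_diff)
  finally have "real (num_conjugacy_classes H) = (real p ^ 3 - real p) / real p + real p"
    by (simp add: card_center)
  also have "(real p ^ 3 - real p) / real p = real p ^ 2 - 1"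
    using p_gt_1 by (simp add: diff_divide_distrib power2_eq_square power3_eq_cube)
  finally show ?thesis by simp
qed

text \<open>For two noncentral elements, centralizers of order \<open>p ^ 2\<close> share the center
  of order \<open>p\<close>. If one element is central, the center alone is too small, but the
  intersection is the other centralizer: order at least \<open>p ^ 2\<close>, against at most
  \<open>p ^ 3\<close>.\<close>

lemma heisenberg_overlap:
  assumes x: "x \<in> carrier H" and y: "y \<in> carrier H"
  shows "1 / real p \<le> (\<Sum>z\<in>carrier H. min (commuting_matrix H x z) (commuting_matrix H y z))"
proof -
  let ?I = "centralizer H x \<inter> centralizer H y"
  have card_cases: "card (centralizer H z) = p ^ 2 \<or> card (centralizer H z) = p ^ 3"
    if "z \<in> carrier H" for z
    using that card_centralizer_noncentral centralizer_central card_heisenberg_group by metis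
  have ge: "p ^ 2 \<le> card (centralizer H z)" and le: "card (centralizer H z) \<le> p ^ 3"
    if "z \<in> carrier H" for z
    using card_cases[OF that] p_gt_1 by (auto intro: power_increasing)
  have "card (centralizer H x) \<le> p * card ?I \<and> card (centralizer H y) \<le> p * card ?I"
  proof (cases "x \<in> Z \<or> y \<in> Z")
    case True
    then have "?I = centralizer H x \<or> ?I = centralizer H y"
      using centralizer_central by (auto simp: centralizer_def)
    then have "p ^ 2 \<le> card ?I" using ge x y by metis
    then have "p ^ 3 \<le> p * card ?I" by (simp add: power2_eq_square power3_eq_cube)
    then show ?thesis using le x y order_trans by blast
  next
    case False
    have "Z \<subseteq> ?I" using center_subset_centralizer x y by blast
    then have "p \<le> card ?I"
      using card_mono[of ?I Z] finite_centralizer[OF finite_heisenberg] by (simp add: card_center)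
    then show ?thesis
      using False x y by (simp add: card_centralizer_noncentral power2_eq_square)
  qed
  then have "real (card (centralizer H x)) \<le> real p * card ?I"
    "real (card (centralizer H y)) \<le> real p * card ?I"
    by (simp_all flip: of_nat_mult)
  then show ?thesis
    using p_gt_1 by (intro commuting_overlap_ge finite_heisenberg x y) (auto simp: field_simps)
qed

section \<open>Distance to stationarity and mixing times on the Heisenberg group\<close>

interpretation chain: finite_markov_chain "carrier H" "commuting_matrix H"
  using commuting_chain[OF finite_heisenberg] .

lemma max_tv_dist_heisenberg_le:
  "max_tv_dist (carrier H) (commuting_matrix H) (commuting_stationary H) t \<le> (1 - 1 / real p) ^ t"
  by (intro chain.max_tv_dist_le_overlap heisenberg_overlap sum_commuting_stationary
      commuting_stationary_stationary finite_heisenberg)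
    (simp_all add: commuting_stationary_def)

text \<open>The chain stays in the noncentral part of a maximal abelian subgroup with probability
  \<open>1 - 1 / p\<close> at each step.\<close>

lemma max_tv_dist_heisenberg_ge:
  "(1 - 1 / real p) ^ t - 1 / 5
    \<le> max_tv_dist (carrier H) (commuting_matrix H) (commuting_stationary H) t"
proof -
  define x where "x = heisenberg_matrix 1 0 0"
  define L where "L = centralizer H x - Z"
  have x: "x \<in> carrier H" "x \<notin> Z"
    using p_gt_1 by (auto simp: x_def heisenberg_matrix_mem_iff heisenberg_matrix_eq_iff)
  have xL: "x \<in> L" using x by (simp add: L_def centralizer_def)
  have LS: "L \<subseteq> carrier H" by (auto simp: L_def centralizer_def)
  have cardL: "card L = p ^ 2 - p"
    unfolding L_def using center_subset_centralizer[OF x(1)]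
    by (simp add: card_Diff_subset card_center card_centralizer_noncentral x)
  have realL: "real (card L) = real p ^ 2 - real p"
    unfolding cardL using p_gt_1 self_le_power[of p 2] by (simp add: of_nat_diff)
  \<comment> \<open>Elements of \<open>L\<close> have \<open>b = 0\<close> and \<open>a\<close>
    invertible modulo \<open>p\<close>, so commuting with any of them means having middle right
    entry 0. Hence all rows indexed by \<open>L\<close> coincide.\<close>
  have centralizer_L: "centralizer H y = centralizer H x" if y: "y \<in> L" for y
  proof -
    obtain a b c where abc: "y = heisenberg_matrix a b c"
      "a \<in> {0..<int p}" "b \<in> {0..<int p}" "c \<in> {0..<int p}"
      using y LS heisenberg_carrierE by blast
    have "y \<in> carrier H" using y LS by blast
    then have "int p dvd b"
      using y by (simp add: L_def x_def abc mem_centralizer_heisenberg_iff)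
    then have "b = 0" using abc by (simp add: residue_dvd_iff)
    moreover from this have "a \<noteq> 0" using y abc by (auto simp: L_def)
    then have "coprime (int p) a"
      using abc p by (metis prime_imp_coprime prime_nat_int_transfer residue_dvd_iff)
    ultimately have "heisenberg_matrix u v w \<in> centralizer H y
        \<longleftrightarrow> heisenberg_matrix u v w \<in> centralizer H x"
      if "heisenberg_matrix u v w \<in> carrier H" for u v w
      using that by (simp add: abc x_def mem_centralizer_heisenberg_iff coprime_dvd_mult_right_iff)
    then have "z \<in> centralizer H y \<longleftrightarrow> z \<in> centralizer H x" if "z \<in> carrier H" for z
      using that by (metis heisenberg_carrierE)
    then show ?thesis
      by (auto simp: centralizer_def)
  qed
  have "1 - 1 / real p \<le> (\<Sum>z\<in>L. commuting_matrix H y z)" if y: "y \<in> L" for y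
  proof -
    have "L \<inter> centralizer H x = L" by (auto simp: L_def)
    then show ?thesis
      using p_gt_1 unfolding sum_commuting_matrix[OF finite_heisenberg LS] centralizer_L[OF y]
      by (simp add: realL card_centralizer_noncentral x field_simps power2_eq_square)
  qed
  then have "(1 - 1 / real p) ^ t - sum (commuting_stationary H) L
      \<le> max_tv_dist (carrier H) (commuting_matrix H) (commuting_stationary H) t"
    using p_gt_1 by (intro chain.max_tv_dist_ge_stay[OF LS xL]) simp_all
  moreover have "sum (commuting_stationary H) L \<le> 1 / 5"
  proof -
    have pos: "0 < real p ^ 2 + real p - 1"
      using num_conjugacy_classes_pos[OF finite_heisenberg]
      by (simp flip: num_conjugacy_classes_heisenberg)
    have "sum (commuting_stationary H) L = (\<Sum>y\<in>L. 1 / ((real p ^ 2 + real p - 1) * real p))"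
      using LS by (intro sum.cong)
        (auto simp: commuting_stationary_def num_conjugacy_classes_heisenberg
          card_conjugacy_class_noncentral L_def)
    also have "\<dots> = ((real p - 1) * real p) / ((real p ^ 2 + real p - 1) * real p)"
      by (simp add: realL power2_eq_square left_diff_distrib)
    also have "\<dots> = (real p - 1) / (real p ^ 2 + real p - 1)"
      using p_gt_1 by simp
    \<comment> \<open>Cleared of denominators this is \<open>(p - 2) ^ 2 \<ge> 0\<close>, so 1/5 is
      attained at \<open>p = 2\<close>.\<close>
    also have "\<dots> \<le> 1 / 5"
      using pos zero_le_power2[of "real p - 2"] by
        (simp add: divide_le_eq power2_eq_square algebra_simps)
    finally show ?thesis .
  qed
  ultimately show ?thesis by linarith
qed

text \<open>Follows from \<open>1 - 1 / p \<le> exp (- 1 / p)\<close>. It gives the upper bound on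
  the mixing time and also the witness that the level \<epsilon> is reached, which the lower bound
  uses.\<close>

lemma max_tv_dist_heisenberg_at_log:
  assumes "0 < \<epsilon>" "\<epsilon> \<le> 1"
  shows "max_tv_dist (carrier H) (commuting_matrix H) (commuting_stationary H)
    (nat \<lceil>real p * ln (1 / \<epsilon>)\<rceil>) \<le> \<epsilon>"
proof -
  define t where "t = nat \<lceil>real p * ln (1 / \<epsilon>)\<rceil>"
  have "real p * ln (1 / \<epsilon>) \<le> real t" unfolding t_def by (rule real_nat_ceiling_ge)
  then have t: "ln (1 / \<epsilon>) \<le> real t / real p" using p_gt_1 by (simp add: field_simps)
  have "(1 - 1 / real p) ^ t \<le> exp (- 1 / real p) ^ t"
    using p_gt_1 exp_ge_add_one_self[of "- 1 / real p"] by (intro power_mono) auto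
  also have "\<dots> = exp (- (real t / real p))"
    by (simp flip: exp_of_nat_mult)
  also have "\<dots> \<le> exp (- ln (1 / \<epsilon>))" using t by simp
  also have "\<dots> = \<epsilon>" using assms by (simp add: ln_div)
  finally show ?thesis
    using max_tv_dist_heisenberg_le[of t] unfolding t_def by linarith
qed

lemma heisenberg_mixing_time_le:
  assumes "0 < \<epsilon>" "\<epsilon> \<le> 1"
  shows "int (commuting_mixing_time H \<epsilon>) \<le> \<lceil>real p * ln (1 / \<epsilon>)\<rceil>"
proof -
  have "commuting_mixing_time H \<epsilon> \<le> nat \<lceil>real p * ln (1 / \<epsilon>)\<rceil>"
    unfolding commuting_mixing_time_def
    by (intro mixing_time_le max_tv_dist_heisenberg_at_log assms)
  \<comment> \<open>Because \<epsilon> is at most 1, \<open>nat\<close> does not truncate the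
    ceiling.\<close>
  moreover have "0 \<le> real p * ln (1 / \<epsilon>)" using assms by simp
  then have "0 \<le> \<lceil>real p * ln (1 / \<epsilon>)\<rceil>" by linarith
  ultimately show ?thesis by linarith
qed

text \<open>Bernoulli's inequality linearizes the lower bound \<open>(1 - 1 / p) ^ t - 1 / 5\<close>
  at the mixing time.\<close>

lemma heisenberg_mixing_time_ge:
  assumes "0 < \<epsilon>" "\<epsilon> \<le> 1"
  shows "real p * (4 / 5 - \<epsilon>) \<le> real (commuting_mixing_time H \<epsilon>)"
proof -
  define t where "t = commuting_mixing_time H \<epsilon>"
  have "max_tv_dist (carrier H) (commuting_matrix H) (commuting_stationary H) t \<le> \<epsilon>"
    unfolding t_def commuting_mixing_time_def
    by (rule max_tv_dist_mixing_time[OF max_tv_dist_heisenberg_at_log[OF assms]])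
  moreover have "1 - real t / real p \<le> (1 - 1 / real p) ^ t"
    using Bernoulli_inequality[of "- 1 / real p" t] p_gt_1 by simp
  ultimately have "4 / 5 - \<epsilon> \<le> real t / real p"
    using max_tv_dist_heisenberg_ge[of t] by linarith
  then show ?thesis
    using p_gt_1 unfolding t_def by (simp add: field_simps)
qed

lemma heisenberg_mixing_time_ratio:
  assumes "10 \<le> p"
  shows "5 / 4 \<le> real (commuting_mixing_time H (1 / 4)) / real (commuting_mixing_time H (3 / 4))"
proof -
  let ?s = "real (commuting_mixing_time H (1 / 4))" and ?t = "real (commuting_mixing_time H (3 / 4))"
  \<comment> \<open>This makes the denominator of the ratio positive.\<close>
  have "real p * (1 / 20) \<le> ?t"
    using heisenberg_mixing_time_ge[of "3 / 4"] by simp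
  then have "0 < ?t" using assms by simp
  have "ln (4 / 3 :: real) \<le> 1 / 3"
    using ln_le_minus_one[of "4 / 3 :: real"] by simp
  then have "real p * ln (4 / 3) \<le> real p / 3"
    using mult_left_mono[of "ln (4 / 3)" "1 / 3" "real p"] by simp
  then have "?t \<le> real p / 3 + 1"
    using heisenberg_mixing_time_le[of "3 / 4"] by simp linarith
  moreover have "real p * (11 / 20) \<le> ?s"
    using heisenberg_mixing_time_ge[of "1 / 4"] by simp
  \<comment> \<open>The gap is at least
    \<open>11 * p / 20 - 5 / 4 * (p / 3 + 1) = 2 * p / 15 - 5 / 4\<close>, positive for
    \<open>p \<ge> 10\<close>.\<close>
  ultimately have "5 / 4 * ?t \<le> ?s"
    using assms by simp
  then show ?thesis
    using \<open>0 < ?t\<close> by (simp add: pos_le_divide_eq)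
qed

end

theorem theorem4p1:
  shows "(\<forall>p::nat. prime p \<longrightarrow>
      real p / 4 \<le> real (commuting_mixing_time (heisenberg_group p) (1 / 4)) \<and>
      int (commuting_mixing_time (heisenberg_group p) (1 / 4)) \<le> \<lceil>real p * ln 4\<rceil>) \<and>
    \<not> exhibits_cutoff
      (\<lambda>n. commuting_mixing_time (heisenberg_group (enumerate {p::nat. prime p} n)))"
proof (intro conjI allI impI)
  fix p :: nat
  assume p: "prime p"
  show "real p / 4 \<le> real (commuting_mixing_time (heisenberg_group p) (1 / 4))"
    using heisenberg_mixing_time_ge[OF p, of "1 / 4"] by simp
  show "int (commuting_mixing_time (heisenberg_group p) (1 / 4)) \<le> \<lceil>real p * ln 4\<rceil>"
    using heisenberg_mixing_time_le[OF p, of "1 / 4"] by simp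
next
  let ?p = "enumerate {p::nat. prime p}"
  let ?T = "\<lambda>n. commuting_mixing_time (heisenberg_group (?p n))"
  show "\<not> exhibits_cutoff ?T"
  proof
    assume "exhibits_cutoff ?T"
    then have "(\<lambda>n. real (?T n (1 / 4)) / real (?T n (1 - 1 / 4))) \<longlonglongrightarrow> 1"
      unfolding exhibits_cutoff_def by (rule bspec) simp
    moreover have "5 / 4 \<le> real (?T n (1 / 4)) / real (?T n (1 - 1 / 4))" if "10 \<le> n" for n
    proof -
      have inf: "infinite {p::nat. prime p}" by (rule primes_infinite)
      have "prime (?p n)" using enumerate_in_set[OF inf, of n] by simp
      \<comment> \<open>The enumeration is increasing, so its entry at \<open>n\<close> is at least
        \<open>n\<close>.\<close>
      moreover have "10 \<le> ?p n" using le_enumerate[OF inf, of n] that by simp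
      ultimately show ?thesis using heisenberg_mixing_time_ratio by simp
    qed
    ultimately have "5 / 4 \<le> (1 :: real)"
      by (intro LIMSEQ_le_const) blast+
    then show False by simp
  qed
qed

end
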